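(* For $\alpha>0$ and $x>0$ let $$\theta_\alpha(x)=\int_0^\infty\left(\frac{\alpha}{e^{\alpha t}-1}-\frac1t+\frac{\alpha}{2}\right)\frac{e^{-tx}}{t}\,dt,$$ and for $p>0$, $\alpha>0$, $q\in\mathbb{R}$ let $f_{p,q;\alpha}(x)=\theta_\alpha(px)-q\,\theta_\alpha(x)$ for $x\in(0,\infty)$. Then the following hold. (i) For all $x>0$, all $\lambda>0$ with $\lambda\ne1$, all integers $k\ge0$ and all $\alpha>0$, $$\frac{(-1)^k}{(1+\lambda)^k}\,\theta_\alpha^{(k)}\left(\frac{x}{1+\lambda}\right)>\frac{(-1)^k}{2}\left[\frac{1}{\lambda^k}\,\theta_\alpha^{(k)}\left(\frac{x}{\lambda}\right)+\theta_\alpha^{(k)}(x)\right].$$ (ii) The function $f_{p,q;\alpha}$ is completely monotonic on $(0,\infty)$ if either $0<p\le1$ and $q\le1$, or $p>1$ and $q\le\frac1p$. The function $-f_{p,q;\alpha}$ is completely monotonic on $(0,\infty)$ if $p\ge1$ and $q\ge1$. (iii) For every $\alpha>0$, the function $-\theta_\alpha$ is star-shaped on $(0,\infty)$ and the function $\theta_\alpha$ is sub-additive on $(0,\infty)$.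
   Context: $\theta_\alpha^{(k)}(y)$ denotes the $k$-th derivative of $\theta_\alpha$ evaluated at the point $y$ (with $\theta_\alpha^{(0)}=\theta_\alpha$). A function $f$ is completely monotonic on an interval $I$ if it has derivatives of all orders on $I$ and $(-1)^nf^{(n)}(x)\ge0$ for all $x\in I$ and all integers $n\ge0$. A function $f$ is star-shaped on $(0,\infty)$ if $f(\sigma x)\le\sigma f(x)$ for all $x\in(0,\infty)$ and $0<\sigma<1$. A function $f$ is super-additive on $(0,\infty)$ if $f(x+y)\ge f(x)+f(y)$ for all $x,y>0$, and $f$ is sub-additive if $-f$ is super-additive. *)

theory Defs
  imports "HOL-Analysis.Analysis"
begin

definition theta :: "real \<Rightarrow> real \<Rightarrow> real" where
  "theta \<alpha> x =
     (LBINT t:{0<..}. (\<alpha> / (exp (\<alpha> * t) - 1) - 1 / t + \<alpha> / 2) * (exp (- t * x) / t))"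

definition f_theta :: "real \<Rightarrow> real \<Rightarrow> real \<Rightarrow> real \<Rightarrow> real" where
  "f_theta p q \<alpha> x = theta \<alpha> (p * x) - q * theta \<alpha> x"

(* Iterated two-sided derivatives: meant for open intervals I only, where they depend
   only on the values of f on I. The differentiability clause is what makes the
   total function deriv meaningful at every order. *)
definition completely_monotonic_on :: "real set \<Rightarrow> (real \<Rightarrow> real) \<Rightarrow> bool" where
  "completely_monotonic_on I f \<longleftrightarrow>
     (\<forall>n. \<forall>x\<in>I. (deriv ^^ n) f field_differentiable at x) \<and>
     (\<forall>n. \<forall>x\<in>I. (-1) ^ n * (deriv ^^ n) f x \<ge> 0)"

(* The following three notions concern functions on the half-line (0,\<infinity>);
   values at non-positive arguments are irrelevant. *)
definition star_shaped :: "(real \<Rightarrow> real) \<Rightarrow> bool" where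
  "star_shaped f \<longleftrightarrow> (\<forall>x>0. \<forall>\<sigma>. 0 < \<sigma> \<and> \<sigma> < 1 \<longrightarrow> f (\<sigma> * x) \<le> \<sigma> * f x)"

definition super_additive :: "(real \<Rightarrow> real) \<Rightarrow> bool" where
  "super_additive f \<longleftrightarrow> (\<forall>x>0. \<forall>y>0. f (x + y) \<ge> f x + f y)"

definition sub_additive :: "(real \<Rightarrow> real) \<Rightarrow> bool" where
  "sub_additive f \<longleftrightarrow> super_additive (\<lambda>x. - f x)"

end

theory Submission
  imports Defs
begin

text \<open>
  Write \<open>g t = \<alpha> / (exp (\<alpha> t) - 1) - 1 / t + \<alpha> / 2\<close>, so that \<open>\<theta>\<close> is the Laplace transform of \<open>g t / t\<close>.
  The measure \<open>dt / t\<close> is invariant under dilations, hence the substitution \<open>t = c s\<close> gives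
  \<open>\<theta> (x / c) = \<integral> g (c s) / s * exp (- s x) ds\<close>, and after \<open>k\<close> differentiations
  \<open>(-1)^k / c^k * \<theta>^(k) (x / c) = \<integral> s^(k - 1) * g (c s) * exp (- s x) ds\<close>.
  All values of \<open>\<theta>\<close> that the theorem compares are thereby integrals against the same exponential,
  and each part reduces to a pointwise inequality for \<open>g\<close>:

  \<^item> the inequality for \<open>\<theta>^(k)\<close> holds because \<open>g ((1 + \<lambda>) s)\<close> exceeds both \<open>g (\<lambda> s)\<close> and \<open>g s\<close>, hence
    also their mean;
  \<^item> \<open>f_theta p q \<alpha>\<close> is the transform of \<open>(g (s / p) - q * g s) / s\<close>, whose sign is settled by comparing
    \<open>g (s / p)\<close> with \<open>g s\<close>, as \<open>g\<close> increases, and with \<open>g s / p\<close>, as \<open>g t / t\<close> decreases; a Laplace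
    transform of a nonnegative function is completely monotonic;
  \<^item> star-shapedness of \<open>- \<theta>\<close> and sub-additivity of \<open>\<theta>\<close> hold because \<open>\<theta>\<close> is nonnegative and
    decreasing, which follows from positivity of \<open>g\<close>.

  So three facts are needed for \<open>t > 0\<close>: \<open>g\<close> is positive, \<open>g\<close> is strictly increasing, \<open>g t / t\<close> is decreasing
  (and bounded, for convergence at 0). They come from the identity
  \<open>g t = \<alpha> / 2 * L (\<alpha> t / 2)\<close> with the Langevin function \<open>L u = coth u - 1 / u\<close>, for which they amount
  to elementary inequalities between \<open>u\<close>, \<open>sinh u\<close> and \<open>cosh u\<close>. The analytic part is
  differentiation under the integral sign, done here by a quadratic estimate of the remainder.
\<close>

section \<open>The Langevin function\<close>

definition langevin :: "real \<Rightarrow> real" where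
  "langevin u = cosh u / sinh u - 1 / u"

text \<open>The hyperbolic inequalities below compare functions that vanish at 0; an inequality
  between derivatives then integrates to one between the functions.\<close>

lemma pos_by_deriv_pos:
  fixes f f' :: "real \<Rightarrow> real"
  assumes "u > 0" and "f 0 = 0"
    and D: "\<And>v. (f has_real_derivative f' v) (at v)"
    and pos: "\<And>v. v > 0 \<Longrightarrow> f' v > 0"
  shows "f u > 0"
proof -
  have "f 0 < f u"
  proof (rule DERIV_pos_imp_increasing_open[OF \<open>u > 0\<close>])
    show "\<exists>y. (f has_real_derivative y) (at v) \<and> y > 0" if "0 < v" "v < u" for v
      using D pos that by blast
    show "continuous_on {0..u} f"
      using D by (auto intro!: continuous_at_imp_continuous_on DERIV_isCont)
  qed
  with \<open>f 0 = 0\<close> show ?thesis by simp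
qed

lemma less_sinh:
  assumes "u > 0" shows "u < sinh (u::real)"
proof -
  have "sinh u - u > 0"
  proof (rule pos_by_deriv_pos[OF assms, where f' = "\<lambda>v. cosh v - 1"])
    show "((\<lambda>v. sinh v - v) has_real_derivative cosh v - 1) (at v)" for v :: real
      by (auto intro!: derivative_eq_intros)
    show "cosh v - 1 > 0" if "v > 0" for v :: real
      using cosh_real_strict_mono[of 0 v] that by simp
  qed simp
  thus ?thesis by simp
qed

lemma sinh_less_times_cosh:
  assumes "u > 0" shows "sinh u < u * cosh (u::real)"
proof -
  have "u * cosh u - sinh u > 0"
  proof (rule pos_by_deriv_pos[OF assms, where f' = "\<lambda>v. v * sinh v"])
    show "((\<lambda>v. v * cosh v - sinh v) has_real_derivative v * sinh v) (at v)" for v :: real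
      by (auto intro!: derivative_eq_intros)
  qed auto
  thus ?thesis by simp
qed

lemma langevin_pos:
  assumes "u > 0" shows "langevin u > 0"
  using sinh_less_times_cosh[OF assms] assms by (simp add: langevin_def field_simps)

text \<open>The bound is the linear term of the expansion of \<open>langevin\<close> at 0. It makes the integrand of
  \<open>\<theta>\<close> bounded near 0.\<close>

lemma langevin_le_third:
  assumes "u > 0" shows "langevin u \<le> u / 3"
proof -
  have "u\<^sup>2 * sinh u - 3 * (u * cosh u - sinh u) > 0"
  proof (rule pos_by_deriv_pos[OF assms, where f' = "\<lambda>v. v * (v * cosh v - sinh v)"])
    show "((\<lambda>v. v\<^sup>2 * sinh v - 3 * (v * cosh v - sinh v)) has_real_derivative
            v * (v * cosh v - sinh v)) (at v)" for v :: real
      by (auto intro!: derivative_eq_intros simp: algebra_simps power2_eq_square)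
  qed (use sinh_less_times_cosh in auto)
  moreover have "sinh u > 0" using assms by simp
  ultimately show ?thesis
    using assms by (simp add: langevin_def field_simps power2_eq_square)
qed

lemma DERIV_langevin:
  assumes "u > 0"
  shows "(langevin has_real_derivative 1 / u\<^sup>2 - 1 / (sinh u)\<^sup>2) (at u)"
proof -
  have "sinh u \<noteq> 0" using assms by simp
  moreover have "((\<lambda>u. cosh u / sinh u - 1 / u) has_real_derivative
      (sinh u * sinh u - cosh u * cosh u) / (sinh u * sinh u) - - 1 / (u * u)) (at u)"
    using assms calculation by (auto intro!: derivative_eq_intros)
  moreover have "sinh u * sinh u - cosh u * cosh u = -1"
    using cosh_square_eq[of u] by (simp add: power2_eq_square)
  ultimately show ?thesis
    by (simp add: langevin_def[abs_def] power2_eq_square)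
qed

lemma langevin_strict_mono:
  assumes "0 < u" "u < v" shows "langevin u < langevin v"
proof (rule DERIV_pos_imp_increasing[OF \<open>u < v\<close>])
  fix w assume "u \<le> w" "w \<le> v"
  hence w: "w > 0" using assms by simp
  have "w\<^sup>2 < (sinh w)\<^sup>2"
    using less_sinh[OF w] w by (intro power_strict_mono) auto
  hence "1 / w\<^sup>2 - 1 / (sinh w)\<^sup>2 > 0"
    using w by (simp add: frac_less2)
  with DERIV_langevin[OF w]
  show "\<exists>y. (langevin has_real_derivative y) (at w) \<and> y > 0" by blast
qed

text \<open>This inequality is what a negative derivative of \<open>langevin u / u\<close> amounts to once denominators
  are cleared. The expansions of both sides at 0 agree up to the fifth order, so the sign shows only
  after differentiating twice: the second derivative of the difference is
  \<open>4 * sinh u * (u * cosh u - sinh u)\<close>.\<close>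

lemma two_sinh_square_less:
  assumes "u > 0"
  shows "2 * (sinh u)\<^sup>2 < u\<^sup>2 + u * sinh u * cosh (u::real)"
proof -
  \<comment> \<open>The shape in which products of \<open>cosh\<close> occur after normalisation by associativity.\<close>
  have cosh_cosh: "cosh w * (cosh w * a) = a + sinh w * (sinh w * a)" for w a :: real
    using cosh_square_eq[of w] by (simp add: power2_eq_square distrib_right flip: mult.assoc)
  have inner: "3 * v + 2 * v * (sinh v)\<^sup>2 - 3 * sinh v * cosh v > 0" if "v > 0" for v :: real
  proof (rule pos_by_deriv_pos[OF that, where f' = "\<lambda>w. 4 * sinh w * (w * cosh w - sinh w)"])
    show "((\<lambda>v. 3 * v + 2 * v * (sinh v)\<^sup>2 - 3 * sinh v * cosh v) has_real_derivative
            4 * sinh w * (w * cosh w - sinh w)) (at w)" for w :: real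
      by (auto intro!: derivative_eq_intros
            simp: algebra_simps power2_eq_square cosh_cosh)
  qed (use sinh_less_times_cosh in auto)
  have "u\<^sup>2 + u * sinh u * cosh u - 2 * (sinh u)\<^sup>2 > 0"
  proof (rule pos_by_deriv_pos[OF assms,
          where f' = "\<lambda>v. 3 * v + 2 * v * (sinh v)\<^sup>2 - 3 * sinh v * cosh v"])
    show "((\<lambda>u. u\<^sup>2 + u * sinh u * cosh u - 2 * (sinh u)\<^sup>2) has_real_derivative
            3 * v + 2 * v * (sinh v)\<^sup>2 - 3 * sinh v * cosh v) (at v)" for v :: real
      by (auto intro!: derivative_eq_intros
            simp: algebra_simps power2_eq_square cosh_square_eq[unfolded power2_eq_square])
  qed (use inner in auto)
  thus ?thesis by simp
qed

lemma langevin_over_id_antimono: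
  assumes "0 < u" "u \<le> v" shows "langevin v / v \<le> langevin u / u"
proof (rule DERIV_nonpos_imp_nonincreasing[OF \<open>u \<le> v\<close>])
  fix w assume "u \<le> w" "w \<le> v"
  hence w: "w > 0" using assms by simp
  hence s: "sinh w > 0" by simp
  have "((\<lambda>u. langevin u / u) has_real_derivative
           ((1 / w\<^sup>2 - 1 / (sinh w)\<^sup>2) * w - langevin w) / (w * w)) (at w)"
    using w by (auto intro!: derivative_eq_intros DERIV_langevin)
  moreover have "(1 / w\<^sup>2 - 1 / (sinh w)\<^sup>2) * w - langevin w
      = (2 * (sinh w)\<^sup>2 - (w\<^sup>2 + w * sinh w * cosh w)) / (w * (sinh w)\<^sup>2)"
    using w s by (simp add: langevin_def field_simps power2_eq_square)
  moreover have "\<dots> / (w * w) \<le> 0"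
    using two_sinh_square_less[OF w] w s by (intro divide_nonpos_pos) auto
  ultimately show "\<exists>y. ((\<lambda>u. langevin u / u) has_real_derivative y) (at w) \<and> y \<le> 0"
    by auto
qed


section \<open>Monotonicity of the weight of theta\<close>

definition theta_weight :: "real \<Rightarrow> real \<Rightarrow> real" where
  "theta_weight \<alpha> t = \<alpha> / (exp (\<alpha> * t) - 1) - 1 / t + \<alpha> / 2"

text \<open>Since \<open>1 / (exp (2 u) - 1) + 1 / 2 = coth u / 2\<close>, the two constants in the weight combine into a
  hyperbolic cotangent with \<open>u = \<alpha> t / 2\<close>.\<close>

lemma theta_weight_eq_langevin:
  assumes "\<alpha> > 0" "t > 0"
  shows "theta_weight \<alpha> t = \<alpha> / 2 * langevin (\<alpha> * t / 2)"
proof -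
  define e where "e = exp (\<alpha> * t / 2)"
  have e: "e > 1" and e2: "exp (\<alpha> * t) = e * e"
    using assms by (auto simp: e_def exp_add[symmetric])
  have "e * e > 1" using e by (simp add: less_1_mult)
  moreover have coth: "cosh (\<alpha> * t / 2) / sinh (\<alpha> * t / 2) = (e * e + 1) / (e * e - 1)"
    using e \<open>e * e > 1\<close> by (simp add: cosh_def sinh_def exp_minus e_def[symmetric] field_simps)
  ultimately show ?thesis
    unfolding theta_weight_def langevin_def e2 coth using assms by (simp add: field_simps)
qed

lemma theta_weight_pos:
  assumes "\<alpha> > 0" "t > 0" shows "theta_weight \<alpha> t > 0"
  using assms by (simp add: theta_weight_eq_langevin langevin_pos)

lemma theta_weight_strict_mono:
  assumes "\<alpha> > 0" "0 < s" "s < t" shows "theta_weight \<alpha> s < theta_weight \<alpha> t"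
  using assms by (simp add: theta_weight_eq_langevin langevin_strict_mono)

lemma theta_weight_over_id_antimono:
  assumes "\<alpha> > 0" "0 < s" "s \<le> t" shows "theta_weight \<alpha> t / t \<le> theta_weight \<alpha> s / s"
proof -
  have *: "theta_weight \<alpha> r / r = (\<alpha> / 2)\<^sup>2 * (langevin (\<alpha> * r / 2) / (\<alpha> * r / 2))" if "r > 0" for r
    using that assms(1) by (simp add: theta_weight_eq_langevin power2_eq_square field_simps)
  have "langevin (\<alpha> * t / 2) / (\<alpha> * t / 2) \<le> langevin (\<alpha> * s / 2) / (\<alpha> * s / 2)"
    using assms by (intro langevin_over_id_antimono) auto
  thus ?thesis
    using assms *[of s] *[of t] by (simp only: mult_left_mono zero_le_power2)
qed

lemma theta_weight_over_id_le:
  assumes "\<alpha> > 0" "t > 0" shows "theta_weight \<alpha> t / t \<le> \<alpha>\<^sup>2 / 12"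
  using langevin_le_third[of "\<alpha> * t / 2"] assms
  by (simp add: theta_weight_eq_langevin field_simps power2_eq_square)


section \<open>Laplace transforms\<close>

definition laplace :: "(real \<Rightarrow> real) \<Rightarrow> real \<Rightarrow> real" where
  "laplace \<phi> x = (LBINT t:{0<..}. \<phi> t * exp (- t * x))"

text \<open>Integrability is demanded at every positive argument, rather than at one, so that the class is
  closed under multiplication by powers of \<open>t\<close>: a factor \<open>t\<close> is paid for by halving \<open>x\<close>. All
  derivatives of a transform are then transforms of functions of the same class.\<close>

definition laplace_integrable :: "(real \<Rightarrow> real) \<Rightarrow> bool" where
  "laplace_integrable \<phi> \<longleftrightarrow> (\<forall>x>0. set_integrable lborel {0<..} (\<lambda>t. \<phi> t * exp (- t * x)))"

lemma laplace_integrableD: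
  "laplace_integrable \<phi> \<Longrightarrow> x > 0 \<Longrightarrow> set_integrable lborel {0<..} (\<lambda>t. \<phi> t * exp (- t * x))"
  by (simp add: laplace_integrable_def)

lemma set_integrable_exp_neg:
  assumes "x > 0" shows "set_integrable lborel {0<..} (\<lambda>t::real. exp (- t * x))"
proof -
  have "(\<lambda>t::real. exp (- x * t)) absolutely_integrable_on {0..}"
    using integrable_on_exp_minus_to_infinity[OF assms, of 0]
    by (intro nonnegative_absolutely_integrable_1) auto
  hence "set_integrable lborel {0..} (\<lambda>t::real. exp (- t * x))"
    by (simp add: set_integrable_def integrable_completion mult.commute)
  thus ?thesis by (rule set_integrable_subset) auto
qed

lemma laplace_integrable_bounded:
  assumes meas: "\<phi> \<in> borel_measurable borel"
    and bound: "\<And>t. t > 0 \<Longrightarrow> \<bar>\<phi> t\<bar> \<le> C"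
  shows "laplace_integrable \<phi>"
  unfolding laplace_integrable_def
proof (intro allI impI)
  fix x :: real assume "x > 0"
  have "set_integrable lborel {0<..} (\<lambda>t. C * exp (- t * x))"
    using set_integrable_exp_neg[OF \<open>x > 0\<close>] by simp
  thus "set_integrable lborel {0<..} (\<lambda>t. \<phi> t * exp (- t * x))"
  proof (rule set_integrable_bound)
    show "set_borel_measurable lborel {0<..} (\<lambda>t. \<phi> t * exp (- t * x))"
      unfolding set_borel_measurable_def using meas by measurable
    show "AE t in lborel. t \<in> {0<..} \<longrightarrow>
        norm (\<phi> t * exp (- t * x)) \<le> norm (C * exp (- t * x))"
    proof (intro AE_I2 impI)
      fix t :: real assume "t \<in> {0<..}"
      hence "\<bar>\<phi> t\<bar> \<le> \<bar>C\<bar>" using bound[of t] by simp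
      thus "norm (\<phi> t * exp (- t * x)) \<le> norm (C * exp (- t * x))"
        by (simp add: abs_mult mult_right_mono)
    qed
  qed
qed

lemma laplace_integrable_times_id:
  assumes "laplace_integrable \<phi>" shows "laplace_integrable (\<lambda>t. t * \<phi> t)"
  unfolding laplace_integrable_def
proof (intro allI impI)
  fix x :: real assume x: "x > 0"
  have half: "set_integrable lborel {0<..} (\<lambda>t. \<phi> t * exp (- t * (x / 2)))"
    by (rule laplace_integrableD[OF assms]) (use x in simp)
  have eq: "t * \<phi> t * exp (- t * x)
      = (t * exp (- t * (x / 2))) * (\<phi> t * exp (- t * (x / 2)))" for t
    by (simp add: exp_add[symmetric])
  show "set_integrable lborel {0<..} (\<lambda>t. t * \<phi> t * exp (- t * x))"
    unfolding eq
  proof (rule set_integrable_bound[where f = "\<lambda>t. 2 / x * (\<phi> t * exp (- t * (x / 2)))"])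
    show "set_integrable lborel {0<..} (\<lambda>t. 2 / x * (\<phi> t * exp (- t * (x / 2))))"
      using half by (rule set_integrable_mult_right)
    have m: "(\<lambda>t. indicator {0<..} t *\<^sub>R (\<phi> t * exp (- t * (x / 2)))) \<in> borel_measurable lborel"
      using half unfolding set_integrable_def by (rule borel_measurable_integrable)
    have "(\<lambda>t. (t * exp (- t * (x / 2))) *
        (indicator {0<..} t *\<^sub>R (\<phi> t * exp (- t * (x / 2))))) \<in> borel_measurable lborel"
      by (rule borel_measurable_times[OF _ m]) measurable
    thus "set_borel_measurable lborel {0<..}
        (\<lambda>t. (t * exp (- t * (x / 2))) * (\<phi> t * exp (- t * (x / 2))))"
      by (simp add: set_borel_measurable_def mult_ac)
    \<comment> \<open>Half of the exponential decay absorbs the factor \<open>t\<close>.\<close>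
    have "t * exp (- t * (x / 2)) \<le> 2 / x" if "t > 0" for t
    proof -
      have "t * (x / 2) \<le> exp (t * (x / 2))"
        using exp_ge_add_one_self[of "t * (x / 2)"] by linarith
      thus ?thesis using x by (simp add: exp_minus field_simps)
    qed
    thus "AE t in lborel. t \<in> {0<..} \<longrightarrow>
        norm ((t * exp (- t * (x / 2))) * (\<phi> t * exp (- t * (x / 2))))
        \<le> norm (2 / x * (\<phi> t * exp (- t * (x / 2))))"
      using x by (intro AE_I2 impI) (auto simp only: norm_mult intro!: mult_right_mono, auto)
  qed
qed

lemma laplace_integrable_times_power:
  assumes "laplace_integrable \<phi>" shows "laplace_integrable (\<lambda>t. t ^ n * \<phi> t)"
proof (induction n)
  case (Suc n)
  from laplace_integrable_times_id[OF this] show ?case by (simp add: mult.assoc)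
qed (use assms in simp)

lemma laplace_integrable_cmult:
  "laplace_integrable \<phi> \<Longrightarrow> laplace_integrable (\<lambda>t. c * \<phi> t)"
  by (simp add: laplace_integrable_def mult.assoc)

lemma laplace_integrable_add:
  "laplace_integrable \<phi> \<Longrightarrow> laplace_integrable \<psi> \<Longrightarrow> laplace_integrable (\<lambda>t. \<phi> t + \<psi> t)"
  by (simp add: laplace_integrable_def distrib_right set_integral_add)

lemma laplace_integrable_diff:
  "laplace_integrable \<phi> \<Longrightarrow> laplace_integrable \<psi> \<Longrightarrow> laplace_integrable (\<lambda>t. \<phi> t - \<psi> t)"
  by (simp add: laplace_integrable_def left_diff_distrib set_integral_diff)

lemma laplace_integrable_abs:
  "laplace_integrable \<phi> \<Longrightarrow> laplace_integrable (\<lambda>t. \<bar>\<phi> t\<bar>)"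
  unfolding laplace_integrable_def using set_integrable_abs by (fastforce simp: abs_mult)

lemma laplace_cmult: "laplace (\<lambda>t. c * \<phi> t) x = c * laplace \<phi> x"
  by (simp add: laplace_def mult.assoc)

lemma laplace_add:
  "laplace_integrable \<phi> \<Longrightarrow> laplace_integrable \<psi> \<Longrightarrow> x > 0 \<Longrightarrow>
     laplace (\<lambda>t. \<phi> t + \<psi> t) x = laplace \<phi> x + laplace \<psi> x"
  by (simp add: laplace_integrable_def laplace_def distrib_right set_integral_add)

lemma laplace_diff:
  "laplace_integrable \<phi> \<Longrightarrow> laplace_integrable \<psi> \<Longrightarrow> x > 0 \<Longrightarrow>
     laplace (\<lambda>t. \<phi> t - \<psi> t) x = laplace \<phi> x - laplace \<psi> x"
  by (simp add: laplace_integrable_def laplace_def left_diff_distrib set_integral_diff)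

lemma laplace_nonneg:
  assumes "\<And>t. t > 0 \<Longrightarrow> \<phi> t \<ge> 0" shows "laplace \<phi> x \<ge> 0"
  unfolding laplace_def set_lebesgue_integral_def
  using assms by (intro integral_nonneg_AE AE_I2) (auto simp: indicator_def)

text \<open>A nonnegative integrand with integral 0 vanishes almost everywhere, which would make the unit
  interval a null set.\<close>

lemma laplace_pos:
  assumes "laplace_integrable \<phi>" "x > 0" and pos: "\<And>t. t > 0 \<Longrightarrow> \<phi> t > 0"
  shows "laplace \<phi> x > 0"
proof -
  have "laplace \<phi> x \<noteq> 0"
  proof
    assume "laplace \<phi> x = 0"
    define F where "F t = indicator {0<..} t *\<^sub>R (\<phi> t * exp (- t * x))" for t
    have "integrable lborel F"
      using assms by (simp add: laplace_integrable_def set_integrable_def F_def[abs_def])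
    moreover have "AE t in lborel. 0 \<le> F t"
      using pos by (intro AE_I2) (auto simp: F_def indicator_def less_imp_le)
    moreover have "integral\<^sup>L lborel F = 0"
      using \<open>laplace \<phi> x = 0\<close> by (simp add: laplace_def set_lebesgue_integral_def F_def[abs_def])
    ultimately have "AE t in lborel. F t = 0"
      by (simp add: integral_nonneg_eq_0_iff_AE)
    hence "AE t in lborel. t \<notin> {0<..<1::real}"
      by eventually_elim (use pos in \<open>force simp: F_def indicator_def\<close>)
    hence "{0<..<1::real} \<in> null_sets lborel"
      by (subst AE_iff_null_sets) auto
    hence "emeasure lborel {0<..<1::real} = 0"
      by (rule null_setsD1)
    thus False by simp
  qed
  with laplace_nonneg[of \<phi> x] pos show ?thesis by (force simp: less_imp_le)
qed

lemma laplace_antimono: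
  assumes "laplace_integrable \<phi>" "\<And>t. t > 0 \<Longrightarrow> \<phi> t \<ge> 0" "0 < x" "x \<le> y"
  shows "laplace \<phi> y \<le> laplace \<phi> x"
  unfolding laplace_def using assms
  by (intro set_integral_mono) (auto simp: laplace_integrable_def intro!: mult_left_mono)

text \<open>Only positive \<open>c\<close> keeps the half-line; the factor \<open>c\<close> on the function is the Jacobian.\<close>

lemma laplace_rescale:
  assumes "c > 0"
  shows "laplace_integrable \<phi> \<Longrightarrow> laplace_integrable (\<lambda>s. c * \<phi> (c * s))"
    and "laplace (\<lambda>s. c * \<phi> (c * s)) x = laplace \<phi> (x / c)"
proof -
  define F where "F x t = indicator {0<..} t *\<^sub>R (\<phi> t * exp (- t * (x / c)))" for x t
  have eq: "indicator {0<..} s *\<^sub>R (c * \<phi> (c * s) * exp (- s * x)) = c * F x (0 + c * s)" for s x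
    using assms by (auto simp: F_def indicator_def zero_less_mult_iff)
  show "laplace_integrable (\<lambda>s. c * \<phi> (c * s))" if "laplace_integrable \<phi>"
    unfolding laplace_integrable_def set_integrable_def eq
  proof (intro allI impI)
    fix x :: real assume "x > 0"
    hence "integrable lborel (F x)"
      using laplace_integrableD[OF that, of "x / c"] assms
      unfolding set_integrable_def F_def[abs_def] by simp
    from lborel_integrable_real_affine[OF this, of c 0] assms
    show "integrable lborel (\<lambda>s. c * F x (0 + c * s))" by simp
  qed
  have "laplace (\<lambda>s. c * \<phi> (c * s)) x = c * (\<integral>s. F x (0 + c * s) \<partial>lborel)"
    unfolding laplace_def set_lebesgue_integral_def eq by simp
  also have "\<dots> = laplace \<phi> (x / c)"
    using lborel_integral_real_affine[of c "F x" 0] assms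
    by (simp add: laplace_def set_lebesgue_integral_def F_def[abs_def])
  finally show "laplace (\<lambda>s. c * \<phi> (c * s)) x = laplace \<phi> (x / c)" .
qed

text \<open>Convexity suffices: the tangent at \<open>a\<close> bounds the remainder at \<open>b\<close> by
  \<open>(a - b) * (exp a - exp b)\<close>, and \<open>exp\<close> is Lipschitz with constant \<open>exp m\<close> below \<open>m\<close>. The quadratic
  factor survives integration and controls the difference quotient of the transform.\<close>

lemma exp_taylor_remainder:
  fixes a b m :: real
  assumes "a \<le> m" "b \<le> m"
  shows "\<bar>exp a - exp b - (a - b) * exp b\<bar> \<le> (a - b)\<^sup>2 * exp m"
proof -
  have tangent: "exp v - exp w \<le> (v - w) * exp v" for v w :: real
  proof -
    have "exp v * (1 + (w - v)) \<le> exp v * exp (w - v)"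
      using exp_ge_add_one_self[of "w - v"] by (intro mult_left_mono) auto
    thus ?thesis by (simp add: exp_add[symmetric] algebra_simps)
  qed
  have lip: "exp v - exp w \<le> (v - w) * exp m" if "w \<le> v" "v \<le> m" for v w :: real
    using tangent[of v w] mult_left_mono[of "exp v" "exp m" "v - w"] that by simp
  have lower: "exp a - exp b - (a - b) * exp b \<ge> 0"
    using tangent[of b a] by (simp add: algebra_simps)
  have "exp a - exp b - (a - b) * exp b \<le> (a - b) * (exp a - exp b)"
    using tangent[of a b] by (simp add: algebra_simps)
  also have "\<dots> = \<bar>a - b\<bar> * \<bar>exp a - exp b\<bar>"
    by (cases "a \<le> b") (auto simp: algebra_simps)
  also have "\<bar>exp a - exp b\<bar> \<le> \<bar>a - b\<bar> * exp m"
    using lip[of b a] lip[of a b] assms by (cases "a \<le> b") auto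
  finally have "exp a - exp b - (a - b) * exp b \<le> \<bar>a - b\<bar> * (\<bar>a - b\<bar> * exp m)"
    by (simp add: mult_left_mono)
  with lower show ?thesis by (simp add: power2_eq_square flip: mult.assoc)
qed

text \<open>For \<open>y > x / 2\<close> both exponents \<open>- t y\<close> and \<open>- t x\<close> lie below \<open>- t x / 2\<close>. The remainder of the
  exponential is therefore at most \<open>(y - x)^2 * t^2 * exp (- t x / 2)\<close>, and integrating this against
  \<open>\<bar>\<phi> t\<bar>\<close> gives a remainder of order \<open>(y - x)^2\<close> for the transform.\<close>

lemma laplace_has_derivative:
  assumes int: "laplace_integrable \<phi>" and x: "x > 0"
  shows "(laplace \<phi> has_real_derivative - laplace (\<lambda>t. t * \<phi> t) x) (at x)"
proof -
  define M where "M = laplace (\<lambda>t. t * (t * \<bar>\<phi> t\<bar>)) (x / 2)"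
  note int1 = laplace_integrable_times_id[OF int]
  note int2 = laplace_integrable_times_id[OF laplace_integrable_times_id[OF laplace_integrable_abs[OF int]]]
  have bound: "\<bar>laplace \<phi> y - laplace \<phi> x + (y - x) * laplace (\<lambda>t. t * \<phi> t) x\<bar> \<le> (y - x)\<^sup>2 * M"
    if y: "y > x / 2" for y
  proof -
    define R where "R t = \<phi> t * exp (- t * y) - \<phi> t * exp (- t * x)
                            + (y - x) * (t * \<phi> t * exp (- t * x))" for t
    have iy: "set_integrable lborel {0<..} (\<lambda>t. \<phi> t * exp (- t * y))"
      and ix: "set_integrable lborel {0<..} (\<lambda>t. \<phi> t * exp (- t * x))"
      and i1: "set_integrable lborel {0<..} (\<lambda>t. (y - x) * (t * \<phi> t * exp (- t * x)))"
      and i2: "set_integrable lborel {0<..}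
                 (\<lambda>t. (y - x)\<^sup>2 * (t * (t * \<bar>\<phi> t\<bar>) * exp (- t * (x / 2))))"
      by (intro set_integrable_mult_right laplace_integrableD int int1 int2; use x y in simp)+
    have iR: "set_integrable lborel {0<..} R"
      unfolding R_def by (intro set_integral_add(1) set_integral_diff(1) iy ix i1)
    have "laplace \<phi> y - laplace \<phi> x + (y - x) * laplace (\<lambda>t. t * \<phi> t) x = (LBINT t:{0<..}. R t)"
      unfolding R_def laplace_def
      by (subst set_integral_add(2)[OF set_integral_diff(1)[OF iy ix] i1],
          subst set_integral_diff(2)[OF iy ix]) simp
    moreover have "\<bar>LBINT t:{0<..}. R t\<bar> \<le> (LBINT t:{0<..}. \<bar>R t\<bar>)"
      using set_integral_norm_bound[OF iR] by simp
    moreover have "(LBINT t:{0<..}. \<bar>R t\<bar>)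
        \<le> (LBINT t:{0<..}. (y - x)\<^sup>2 * (t * (t * \<bar>\<phi> t\<bar>) * exp (- t * (x / 2))))"
    proof (rule set_integral_mono[OF set_integrable_abs[OF iR] i2])
      fix t :: real assume "t \<in> {0<..}"
      hence t: "t > 0" by simp
      have "R t = \<phi> t * (exp (- t * y) - exp (- t * x) - (- t * y - - t * x) * exp (- t * x))"
        by (simp add: R_def algebra_simps)
      hence "\<bar>R t\<bar> = \<bar>\<phi> t\<bar> * \<bar>exp (- t * y) - exp (- t * x) - (- t * y - - t * x) * exp (- t * x)\<bar>"
        by (simp only: abs_mult)
      also have "\<dots> \<le> \<bar>\<phi> t\<bar> * ((- t * y - - t * x)\<^sup>2 * exp (- t * (x / 2)))"
        using x y t by (intro mult_left_mono[OF exp_taylor_remainder abs_ge_zero]) auto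
      also have "(- t * y - - t * x)\<^sup>2 = t * t * (y - x)\<^sup>2"
        by (simp add: power2_eq_square algebra_simps)
      finally show "\<bar>R t\<bar> \<le> (y - x)\<^sup>2 * (t * (t * \<bar>\<phi> t\<bar>) * exp (- t * (x / 2)))"
        by (simp add: mult_ac)
    qed
    ultimately show ?thesis by (simp add: M_def laplace_def)
  qed
  have "((\<lambda>y. (laplace \<phi> y - laplace \<phi> x) / (y - x) - - laplace (\<lambda>t. t * \<phi> t) x) \<longlongrightarrow> 0) (at x)"
  proof (rule Lim_null_comparison)
    have "eventually (\<lambda>y. y > x / 2) (at x)"
      using x by (intro order_tendstoD(1)[OF tendsto_ident_at]) auto
    moreover have "eventually (\<lambda>y. y \<noteq> x) (at x)"
      by (simp add: eventually_at_filter)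
    ultimately show "eventually (\<lambda>y. norm ((laplace \<phi> y - laplace \<phi> x) / (y - x)
        - - laplace (\<lambda>t. t * \<phi> t) x) \<le> \<bar>y - x\<bar> * M) (at x)"
    proof eventually_elim
      case (elim y)
      have "(laplace \<phi> y - laplace \<phi> x) / (y - x) - - laplace (\<lambda>t. t * \<phi> t) x
          = (laplace \<phi> y - laplace \<phi> x + (y - x) * laplace (\<lambda>t. t * \<phi> t) x) / (y - x)"
        using elim(2) by (simp add: field_simps)
      moreover have "\<bar>\<dots>\<bar> \<le> (y - x)\<^sup>2 * M / \<bar>y - x\<bar>"
        using bound[OF elim(1)] by (simp add: divide_right_mono)
      moreover have "(y - x)\<^sup>2 * M / \<bar>y - x\<bar> = \<bar>y - x\<bar> * M"
        using elim(2) by (simp add: field_simps power2_eq_square abs_if)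
      ultimately show ?case by simp
    qed
    show "((\<lambda>y. \<bar>y - x\<bar> * M) \<longlongrightarrow> 0) (at x)"
      by (auto intro!: tendsto_eq_intros)
  qed
  thus ?thesis by (subst has_field_derivative_iff) (rule LIM_zero_cancel)
qed

text \<open>Iterating the derivative formula is legitimate because the half-line is open: agreement with the
  transform on it passes from one derivative to the next.\<close>

lemma iterated_deriv_laplace:
  assumes int: "laplace_integrable \<phi>"
    and f: "\<And>x. x > 0 \<Longrightarrow> f x = laplace \<phi> x"
    and x: "x > 0"
  shows "(deriv ^^ n) f x = (-1) ^ n * laplace (\<lambda>t. t ^ n * \<phi> t) x"
    and "(deriv ^^ n) f field_differentiable at x"
proof -
  have D: "(g has_real_derivative (-1) ^ Suc n * laplace (\<lambda>t. t ^ Suc n * \<phi> t) x) (at x)"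
    if g: "\<And>x. x > 0 \<Longrightarrow> g x = (-1) ^ n * laplace (\<lambda>t. t ^ n * \<phi> t) x" and x: "x > 0"
    for g n x
  proof (rule has_field_derivative_transform_within_open[where S = "{0<..}"])
    show "((\<lambda>x. (-1) ^ n * laplace (\<lambda>t. t ^ n * \<phi> t) x) has_real_derivative
        (-1) ^ Suc n * laplace (\<lambda>t. t ^ Suc n * \<phi> t) x) (at x)"
      using DERIV_cmult[OF laplace_has_derivative[OF laplace_integrable_times_power[OF int] x],
          of "(-1) ^ n" n] by (simp add: mult.assoc)
  qed (use g x in auto)
  have val: "(deriv ^^ n) f x = (-1) ^ n * laplace (\<lambda>t. t ^ n * \<phi> t) x" if "x > 0" for n x
    using that
  proof (induction n arbitrary: x)
    case 0
    thus ?case by (simp add: f)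
  next
    case (Suc n)
    from DERIV_imp_deriv[OF D[OF Suc.IH Suc.prems]] show ?case by simp
  qed
  show "(deriv ^^ n) f x = (-1) ^ n * laplace (\<lambda>t. t ^ n * \<phi> t) x" by (rule val[OF x])
  show "(deriv ^^ n) f field_differentiable at x"
    using D[OF val x] by (auto simp: field_differentiable_def)
qed

text \<open>The elementary direction of Bernstein's theorem: the sign \<open>(-1)^n\<close> of the \<open>n\<close>-th derivative comes
  from the exponential, and \<open>t ^ n * \<phi> t\<close> stays nonnegative.\<close>

lemma completely_monotonic_on_laplace:
  assumes int: "laplace_integrable \<phi>"
    and f: "\<And>x. x > 0 \<Longrightarrow> f x = laplace \<phi> x"
    and nonneg: "\<And>t. t > 0 \<Longrightarrow> \<phi> t \<ge> 0"
  shows "completely_monotonic_on {0<..} f"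
proof -
  have "(-1) ^ n * (deriv ^^ n) f x \<ge> 0" if "x > 0" for n x
  proof -
    have "(-1) ^ n * (deriv ^^ n) f x = laplace (\<lambda>t. t ^ n * \<phi> t) x"
      using iterated_deriv_laplace(1)[OF int f that]
      by (simp add: power_mult_distrib[symmetric] flip: mult.assoc)
    thus ?thesis using nonneg by (simp add: laplace_nonneg)
  qed
  thus ?thesis
    unfolding completely_monotonic_on_def using iterated_deriv_laplace(2)[OF int f] by auto
qed


section \<open>Theta as a Laplace transform\<close>

lemma theta_eq_laplace: "theta \<alpha> x = laplace (\<lambda>t. theta_weight \<alpha> t / t) x"
  by (simp add: theta_def laplace_def theta_weight_def)

lemma laplace_integrable_theta_density:
  assumes "\<alpha> > 0" shows "laplace_integrable (\<lambda>t. theta_weight \<alpha> t / t)"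
proof (rule laplace_integrable_bounded)
  show "(\<lambda>t. theta_weight \<alpha> t / t) \<in> borel_measurable borel"
    unfolding theta_weight_def by measurable
  show "\<bar>theta_weight \<alpha> t / t\<bar> \<le> \<alpha>\<^sup>2 / 12" if "t > 0" for t
    using theta_weight_over_id_le[OF assms that] theta_weight_pos[OF assms that] that by simp
qed

lemma laplace_integrable_rescaled_weight:
  assumes "\<alpha> > 0" "c > 0"
  shows "laplace_integrable (\<lambda>s. theta_weight \<alpha> (c * s) / s)"
  using laplace_rescale(1)[OF assms(2) laplace_integrable_theta_density[OF assms(1)]] assms
  by simp

text \<open>The Jacobian \<open>c\<close> cancels against the denominator \<open>c * s\<close>, so the dilation acts on the weight
  alone.\<close>

lemma theta_rescaled:
  assumes "c > 0"
  shows "theta \<alpha> (x / c) = laplace (\<lambda>s. theta_weight \<alpha> (c * s) / s) x"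
  using laplace_rescale(2)[OF assms, of "\<lambda>t. theta_weight \<alpha> t / t" x] assms
  by (simp add: theta_eq_laplace)

text \<open>Each differentiation brings down a factor \<open>t = c * s\<close>; dividing by \<open>c ^ k\<close> removes the dilation
  from these factors and leaves an integrand that depends on \<open>c\<close> only through the weight.\<close>

lemma iterated_deriv_theta_rescaled:
  assumes "\<alpha> > 0" "c > 0" "x > 0"
  shows "(-1) ^ k / c ^ k * (deriv ^^ k) (theta \<alpha>) (x / c)
       = laplace (\<lambda>s. s ^ k * (theta_weight \<alpha> (c * s) / s)) x"
proof -
  define h where "h t = theta_weight \<alpha> t / t" for t
  have "(deriv ^^ k) (theta \<alpha>) (x / c) = (-1) ^ k * laplace (\<lambda>t. t ^ k * h t) (x / c)"
    unfolding h_def using assms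
    by (intro iterated_deriv_laplace(1) laplace_integrable_theta_density theta_eq_laplace) auto
  also have "laplace (\<lambda>t. t ^ k * h t) (x / c) = laplace (\<lambda>s. c * ((c * s) ^ k * h (c * s))) x"
    using laplace_rescale(2)[OF \<open>c > 0\<close>, of "\<lambda>t. t ^ k * h t" x] by simp
  also have "(\<lambda>s. c * ((c * s) ^ k * h (c * s)))
      = (\<lambda>s. c ^ k * (s ^ k * (theta_weight \<alpha> (c * s) / s)))"
    using assms by (intro ext) (simp add: h_def power_mult_distrib)
  also have "laplace \<dots> x = c ^ k * laplace (\<lambda>s. s ^ k * (theta_weight \<alpha> (c * s) / s)) x"
    by (rule laplace_cmult)
  finally show ?thesis
    using assms by (simp flip: power_mult_distrib)
qed

lemma f_theta_eq_laplace:
  assumes "\<alpha> > 0" "p > 0" "x > 0"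
  shows "f_theta p q \<alpha> x
       = laplace (\<lambda>s. theta_weight \<alpha> (s / p) / s - q * (theta_weight \<alpha> s / s)) x"
proof -
  have "theta \<alpha> (p * x) = laplace (\<lambda>s. theta_weight \<alpha> (s / p) / s) x"
    using theta_rescaled[of "1 / p" \<alpha> x] assms by (simp add: mult.commute)
  moreover have "laplace_integrable (\<lambda>s. theta_weight \<alpha> (s / p) / s)"
    using laplace_integrable_rescaled_weight[of \<alpha> "1 / p"] assms by simp
  ultimately show ?thesis
    unfolding f_theta_def theta_eq_laplace[of \<alpha> x] using assms
    by (simp add: laplace_diff laplace_cmult laplace_integrable_cmult laplace_integrable_theta_density
             del: times_divide_eq_right)
qed

section \<open>Inequalities for theta\<close>

text \<open>By monotonicity of the weight the integrand at dilation \<open>1 + l\<close> exceeds the integrands at \<open>l\<close> and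
  at 1, hence also their mean.\<close>

lemma theta_strict_midpoint:
  assumes "x > 0" "l > 0" "\<alpha> > 0"
  shows "(-1) ^ k / (1 + l) ^ k * (deriv ^^ k) (theta \<alpha>) (x / (1 + l))
       > (-1) ^ k / 2 * (1 / l ^ k * (deriv ^^ k) (theta \<alpha>) (x / l) + (deriv ^^ k) (theta \<alpha>) x)"
proof -
  define \<psi> where "\<psi> c s = s ^ k * (theta_weight \<alpha> (c * s) / s)" for c s
  have int: "laplace_integrable (\<psi> c)" if "c > 0" for c
    unfolding \<psi>_def using assms that
    by (intro laplace_integrable_times_power laplace_integrable_rescaled_weight)
  have val: "(-1) ^ k / c ^ k * (deriv ^^ k) (theta \<alpha>) (x / c) = laplace (\<psi> c) x" if "c > 0" for c
    unfolding \<psi>_def using assms that by (intro iterated_deriv_theta_rescaled)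
  have "0 < laplace (\<lambda>s. \<psi> (1 + l) s - 1 / 2 * (\<psi> l s + \<psi> 1 s)) x"
  proof (rule laplace_pos)
    show "laplace_integrable (\<lambda>s. \<psi> (1 + l) s - 1 / 2 * (\<psi> l s + \<psi> 1 s))"
      using assms
      by (intro laplace_integrable_diff laplace_integrable_cmult laplace_integrable_add int) auto
    fix s :: real assume s: "s > 0"
    have "theta_weight \<alpha> (l * s) < theta_weight \<alpha> ((1 + l) * s)"
      "theta_weight \<alpha> (1 * s) < theta_weight \<alpha> ((1 + l) * s)"
      using assms s by (auto intro!: theta_weight_strict_mono)
    hence "\<psi> l s < \<psi> (1 + l) s" "\<psi> 1 s < \<psi> (1 + l) s"
      unfolding \<psi>_def using s by (auto intro!: mult_strict_left_mono divide_strict_right_mono)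
    thus "\<psi> (1 + l) s - 1 / 2 * (\<psi> l s + \<psi> 1 s) > 0" by simp
  qed (use assms in auto)
  also have "\<dots> = laplace (\<psi> (1 + l)) x - 1 / 2 * (laplace (\<psi> l) x + laplace (\<psi> 1) x)"
    using assms
    by (simp only: laplace_diff laplace_add laplace_cmult int laplace_integrable_cmult
        laplace_integrable_add add_pos_pos zero_less_one)
  finally show ?thesis
    using val[of "1 + l"] val[of l] val[of 1] assms by (simp add: algebra_simps)
qed

lemma laplace_integrable_f_theta_density:
  assumes "\<alpha> > 0" "p > 0"
  shows "laplace_integrable (\<lambda>s. theta_weight \<alpha> (s / p) / s - q * (theta_weight \<alpha> s / s))"
  using laplace_integrable_rescaled_weight[of \<alpha> "1 / p"] assms
  by (intro laplace_integrable_diff laplace_integrable_cmult laplace_integrable_theta_density) auto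

text \<open>For \<open>p \<le> 1\<close> the dilation \<open>1 / p\<close> does not decrease the weight. For \<open>p > 1\<close> it does, but by a
  factor of at most \<open>p\<close>, because the weight divided by its argument is decreasing; this is
  where the threshold \<open>1 / p\<close> comes from.\<close>

lemma f_theta_completely_monotonic:
  assumes "\<alpha> > 0" "p > 0" and pq: "p \<le> 1 \<and> q \<le> 1 \<or> p > 1 \<and> q \<le> 1 / p"
  shows "completely_monotonic_on {0<..} (f_theta p q \<alpha>)"
proof (rule completely_monotonic_on_laplace)
  show "laplace_integrable (\<lambda>s. theta_weight \<alpha> (s / p) / s - q * (theta_weight \<alpha> s / s))"
    using assms by (intro laplace_integrable_f_theta_density)
  show "f_theta p q \<alpha> x
      = laplace (\<lambda>s. theta_weight \<alpha> (s / p) / s - q * (theta_weight \<alpha> s / s)) x" if "x > 0" for x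
    using assms that by (intro f_theta_eq_laplace)
  fix s :: real assume s: "s > 0"
  have "q * theta_weight \<alpha> s \<le> theta_weight \<alpha> (s / p)"
    using pq
  proof
    assume "p \<le> 1 \<and> q \<le> 1"
    hence "q * theta_weight \<alpha> s \<le> 1 * theta_weight \<alpha> s" "s \<le> s / p"
      using assms s theta_weight_pos[of \<alpha> s] by (auto intro!: mult_right_mono simp: field_simps)
    thus ?thesis
      using theta_weight_strict_mono[of \<alpha> s "s / p"] assms s by (cases "s = s / p") auto
  next
    assume p: "p > 1 \<and> q \<le> 1 / p"
    hence "q * theta_weight \<alpha> s \<le> 1 / p * theta_weight \<alpha> s"
      using assms s theta_weight_pos[of \<alpha> s] by (intro mult_right_mono) auto
    also have "theta_weight \<alpha> s / s \<le> theta_weight \<alpha> (s / p) / (s / p)"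
      using assms s p by (intro theta_weight_over_id_antimono) (auto simp: field_simps)
    hence "1 / p * theta_weight \<alpha> s \<le> theta_weight \<alpha> (s / p)"
      using assms s by (simp add: field_simps)
    finally show ?thesis .
  qed
  thus "theta_weight \<alpha> (s / p) / s - q * (theta_weight \<alpha> s / s) \<ge> 0"
    using s by (simp add: divide_right_mono)
qed

lemma minus_f_theta_completely_monotonic:
  assumes "\<alpha> > 0" "p \<ge> 1" "q \<ge> 1"
  shows "completely_monotonic_on {0<..} (\<lambda>x. - f_theta p q \<alpha> x)"
proof (rule completely_monotonic_on_laplace)
  let ?h = "\<lambda>s. theta_weight \<alpha> (s / p) / s - q * (theta_weight \<alpha> s / s)"
  show "laplace_integrable (\<lambda>s. -1 * ?h s)"
    using assms by (intro laplace_integrable_cmult laplace_integrable_f_theta_density) auto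
  show "- f_theta p q \<alpha> x = laplace (\<lambda>s. -1 * ?h s) x" if "x > 0" for x
    unfolding laplace_cmult using f_theta_eq_laplace[of \<alpha> p x q] assms that by simp
  fix s :: real assume s: "s > 0"
  have "s / p \<le> s" using assms s by (simp add: field_simps)
  hence "theta_weight \<alpha> (s / p) \<le> theta_weight \<alpha> s"
    using theta_weight_strict_mono[of \<alpha> "s / p" s] assms s by (cases "s / p = s") auto
  also have "1 * theta_weight \<alpha> s \<le> q * theta_weight \<alpha> s"
    using assms s theta_weight_pos[of \<alpha> s] by (intro mult_right_mono) auto
  hence "theta_weight \<alpha> s \<le> q * theta_weight \<alpha> s" by simp
  finally show "-1 * ?h s \<ge> 0" using s by (simp add: divide_right_mono)
qed

lemma theta_nonneg:
  assumes "\<alpha> > 0" shows "theta \<alpha> x \<ge> 0"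
  unfolding theta_eq_laplace
  using theta_weight_pos[OF assms] by (intro laplace_nonneg) (simp add: less_imp_le)

lemma theta_antimono:
  assumes "\<alpha> > 0" "0 < x" "x \<le> y" shows "theta \<alpha> y \<le> theta \<alpha> x"
  unfolding theta_eq_laplace using theta_weight_pos[OF assms(1)] assms
  by (intro laplace_antimono laplace_integrable_theta_density) (simp_all add: less_imp_le)

lemma star_shaped_minus_theta:
  assumes "\<alpha> > 0" shows "star_shaped (\<lambda>x. - theta \<alpha> x)"
  unfolding star_shaped_def
proof (intro allI impI, elim conjE)
  fix x \<sigma> :: real assume "x > 0" "0 < \<sigma>" "\<sigma> < 1"
  hence "\<sigma> * theta \<alpha> x \<le> 1 * theta \<alpha> x"
    using theta_nonneg[OF assms] by (intro mult_right_mono) auto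
  also have "\<dots> \<le> theta \<alpha> (\<sigma> * x)"
    using theta_antimono[of \<alpha> "\<sigma> * x" x] assms \<open>x > 0\<close> \<open>0 < \<sigma>\<close> \<open>\<sigma> < 1\<close> by simp
  finally show "- theta \<alpha> (\<sigma> * x) \<le> \<sigma> * - theta \<alpha> x" by simp
qed

lemma sub_additive_theta:
  assumes "\<alpha> > 0" shows "sub_additive (theta \<alpha>)"
  unfolding sub_additive_def super_additive_def
proof (intro allI impI)
  fix x y :: real assume "x > 0" "y > 0"
  thus "- theta \<alpha> (x + y) \<ge> - theta \<alpha> x + - theta \<alpha> y"
    using theta_antimono[OF assms, of x "x + y"] theta_nonneg[OF assms, of y] by simp
qed

theorem theorem3:
  shows "(\<forall>(x::real) (l::real) (k::nat) (\<alpha>::real). x > 0 \<longrightarrow> l > 0 \<longrightarrow> l \<noteq> 1 \<longrightarrow> \<alpha> > 0 \<longrightarrow>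
           (-1) ^ k / (1 + l) ^ k * (deriv ^^ k) (theta \<alpha>) (x / (1 + l))
           > (-1) ^ k / 2 * (1 / l ^ k * (deriv ^^ k) (theta \<alpha>) (x / l) + (deriv ^^ k) (theta \<alpha>) x)) \<and>
         (\<forall>(p::real) (q::real) (\<alpha>::real). p > 0 \<longrightarrow> \<alpha> > 0 \<longrightarrow>
           ((0 < p \<and> p \<le> 1 \<and> q \<le> 1) \<or> (p > 1 \<and> q \<le> 1 / p)
              \<longrightarrow> completely_monotonic_on {0<..} (f_theta p q \<alpha>)) \<and>
           (p \<ge> 1 \<and> q \<ge> 1 \<longrightarrow> completely_monotonic_on {0<..} (\<lambda>x. - f_theta p q \<alpha> x))) \<and>
         (\<forall>\<alpha>::real. \<alpha> > 0 \<longrightarrow> star_shaped (\<lambda>x. - theta \<alpha> x) \<and> sub_additive (theta \<alpha>))"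
  using theta_strict_midpoint f_theta_completely_monotonic minus_f_theta_completely_monotonic
    star_shaped_minus_theta sub_additive_theta
  by auto

end
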